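(* Let $\mathbb{G}$ be a stratified group with $N$ being the dimension of the first stratum, $N\geq3$. Then the following two statements are equivalent: (a) For any $f\in C_{0}^{\infty}(\mathbb{G}\setminus\{x'=0\})$, we have $$\|f\|_{L^{2}(\mathbb{G})}\leq \frac{2}{N}\|x'\cdot \nabla_{H}f\|_{L^{2}(\mathbb{G})}.$$ (b) For any $g\in C_{0}^{\infty}(\mathbb{G}\setminus\{x'=0\})$, we have $$\left\|\frac{g}{|x'|}\right\|_{L^{2}(\mathbb{G})}\leq \frac{2}{N-2}\left\|\frac{x'}{|x'|}\cdot \nabla_{H}g\right\|_{L^{2}(\mathbb{G})}.$$
   Context: A Lie group $\mathbb{G}=(\mathbb{R}^{n},\circ)$ is called a stratified group (homogeneous Carnot group) if: (i) for some natural numbers $N=N_1,N_2,\ldots,N_r$ with $N+N_{2}+\ldots+N_{r}=n$, writing $\mathbb{R}^{n}=\mathbb{R}^{N}\times\mathbb{R}^{N_2}\times\ldots\times\mathbb{R}^{N_{r}}$ and $x=(x',x^{(2)},\ldots,x^{(r)})$ with $x'\in\mathbb{R}^N$, $x^{(k)}\in\mathbb{R}^{N_k}$, the dilation $\delta_{\lambda}(x)=(\lambda x',\lambda^{2}x^{(2)},\ldots,\lambda^{r}x^{(r)})$ is an automorphism of $\mathbb{G}$ for every $\lambda>0$; (ii) if $X_{1},\ldots,X_{N}$ are the left invariant vector fields on $\mathbb{G}$ with $X_{k}(0)=\frac{\partial}{\partial x_{k}}|_{0}$ for $k=1,\ldots,N$, then ${\rm rank}({\rm Lie}\{X_{1},\ldots,X_{N}\})=n$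 at every $x\in\mathbb{R}^{n}$, i.e. the iterated commutators of $X_1,\ldots,X_N$ span the Lie algebra of $\mathbb{G}$. The number $N$ is the dimension of the first stratum and $x'$ denotes the variables of the first stratum. The horizontal gradient is $\nabla_{H}=(X_{1},\ldots,X_{N})$, $x'\cdot\nabla_H f=\sum_{k=1}^N x'_k X_k f$, and $|x'|=\sqrt{x_1'^2+\ldots+x_N'^2}$ is the Euclidean norm on $\mathbb{R}^N$. The set $\{x'=0\}$ is $\{x\in\mathbb{G}: x'=0\}$. $L^2(\mathbb{G})$ is taken with respect to Lebesgue measure $dx$ on $\mathbb{R}^n$, which is the Haar measure of $\mathbb{G}$. $C_0^\infty(\Omega)$ denotes smooth complex-valued functions compactly supported in the open set $\Omega$. *)

theory Defs
  imports "HOL-Analysis.Analysis" "HOL-Algebra.Group"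
begin

text \<open>
  \<open>k_smooth k\<close> is \<open>C\<^sup>k\<close> on the whole space, for finite dimensional domains: continuity of
  \<open>x \<mapsto> D f(x) v\<close> for each fixed \<open>v\<close> is then continuity of \<open>D f\<close>.
\<close>

primrec k_smooth :: "nat \<Rightarrow> ('a::real_normed_vector \<Rightarrow> 'b::real_normed_vector) \<Rightarrow> bool" where
  "k_smooth 0 f \<longleftrightarrow> continuous_on UNIV f"
| "k_smooth (Suc k) f \<longleftrightarrow>
     (\<forall>x. f differentiable (at x)) \<and>
     (\<forall>v. k_smooth k (\<lambda>x. frechet_derivative f (at x) v))"

definition smooth :: "('a::real_normed_vector \<Rightarrow> 'b::real_normed_vector) \<Rightarrow> bool" where
  "smooth f \<longleftrightarrow> (\<forall>k. k_smooth k f)"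

text \<open>Elements of \<open>C\<^sub>0\<^sup>\<infinity>(\<Omega>)\<close> are represented by their extensions by zero to the whole space.\<close>

definition test_functions :: "'a::real_normed_vector set \<Rightarrow> ('a \<Rightarrow> complex) set" where
  "test_functions \<Omega> =
     {f. smooth f \<and> compact (closure {x. f x \<noteq> 0}) \<and> closure {x. f x \<noteq> 0} \<subseteq> \<Omega>}"

text \<open>Meaningful for square integrable functions only: a Bochner integral that does not exist is 0.\<close>

definition L2_norm :: "('a::euclidean_space \<Rightarrow> complex) \<Rightarrow> real" where
  "L2_norm f = sqrt (LINT x|lebesgue. (cmod (f x))\<^sup>2)"

text \<open>A vector field is given by its coefficient vector at each point.\<close>

definition vf_apply ::
  "('a::real_normed_vector \<Rightarrow> 'a) \<Rightarrow> ('a \<Rightarrow> 'b::real_normed_vector) \<Rightarrow> 'a \<Rightarrow> 'b" where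
  "vf_apply X f x = frechet_derivative f (at x) (X x)"

text \<open>Sign convention: \<open>[X, Y] f = X (Y f) - Y (X f)\<close>.\<close>

definition lie_bracket ::
  "('a::real_normed_vector \<Rightarrow> 'a) \<Rightarrow> ('a \<Rightarrow> 'a) \<Rightarrow> 'a \<Rightarrow> 'a" where
  "lie_bracket X Y x = vf_apply X Y x - vf_apply Y X x"

inductive_set lie_algebra_gen ::
  "('a::real_normed_vector \<Rightarrow> 'a) set \<Rightarrow> ('a \<Rightarrow> 'a) set" for S where
  gen: "X \<in> S \<Longrightarrow> X \<in> lie_algebra_gen S"
| add: "X \<in> lie_algebra_gen S \<Longrightarrow> Y \<in> lie_algebra_gen S \<Longrightarrow> (\<lambda>x. X x + Y x) \<in> lie_algebra_gen S"
| scale: "X \<in> lie_algebra_gen S \<Longrightarrow> (\<lambda>x. c *\<^sub>R X x) \<in> lie_algebra_gen S"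
| bracket: "X \<in> lie_algebra_gen S \<Longrightarrow> Y \<in> lie_algebra_gen S \<Longrightarrow> lie_bracket X Y \<in> lie_algebra_gen S"

definition left_invariant ::
  "('a::real_normed_vector, 'b) monoid_scheme \<Rightarrow> ('a \<Rightarrow> 'a) \<Rightarrow> bool" where
  "left_invariant G X \<longleftrightarrow>
     (\<forall>a x. frechet_derivative (\<lambda>y. a \<otimes>\<^bsub>G\<^esub> y) (at x) (X x) = X (a \<otimes>\<^bsub>G\<^esub> x))"

text \<open>
  The splitting of \<open>\<real>\<^sup>n\<close> into \<open>\<real>\<^bsup>N\<^sub>1\<^esup> \<times> \<dots> \<times> \<real>\<^bsup>N\<^sub>r\<^esup>\<close> is given by a map \<open>\<sigma>\<close>
  sending each coordinate to the stratum containing it, so \<open>N\<^sub>k\<close> is the number of \<open>i\<close> with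
  \<open>\<sigma> i = k\<close>; no order on the coordinates is involved.
\<close>

definition dilation :: "('n::finite \<Rightarrow> nat) \<Rightarrow> real \<Rightarrow> real ^ 'n \<Rightarrow> real ^ 'n" where
  "dilation \<sigma> t x = (\<chi> i. t ^ \<sigma> i * x $ i)"

definition first_stratum :: "('n \<Rightarrow> nat) \<Rightarrow> 'n set" where
  "first_stratum \<sigma> = {k. \<sigma> k = 1}"

text \<open>
  \<open>X k\<close> is constrained only for \<open>k\<close> in the first stratum, where it is the unique left invariant
  vector field with the prescribed value at 0.
\<close>

locale stratified_group = group G
  for G :: "(real ^ 'n) monoid" (structure) +
  fixes \<sigma> :: "'n::finite \<Rightarrow> nat"
    and r :: nat
    and X :: "'n \<Rightarrow> real ^ 'n \<Rightarrow> real ^ 'n"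
  assumes carrier_UNIV: "carrier G = UNIV"
    and smooth_mult: "smooth (\<lambda>p. fst p \<otimes> snd p)"
    and smooth_inv: "smooth (\<lambda>x. inv x)"
    and strata: "\<And>i. \<sigma> i \<in> {1..r}"
    and dilation_automorphism: "\<And>t. t > 0 \<Longrightarrow> dilation \<sigma> t \<in> iso G G"
    and X_left_invariant: "\<And>k. k \<in> first_stratum \<sigma> \<Longrightarrow> left_invariant G (X k)"
    and X_at_0: "\<And>k. k \<in> first_stratum \<sigma> \<Longrightarrow> X k 0 = axis k 1"
    and rank_condition:
      "\<And>x. dim {Z x | Z. Z \<in> lie_algebra_gen (X ` first_stratum \<sigma>)} = CARD('n)"

text \<open>
  For \<open>hor_dot\<close> only the first stratum components of \<open>v\<close> matter, so that
  \<open>hor_dot \<sigma> x (hor_grad X f x)\<close> is \<open>x' \<cdot> \<nabla>\<^sub>H f\<close> at \<open>x\<close>.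
\<close>

definition hor_norm :: "('n::finite \<Rightarrow> nat) \<Rightarrow> real ^ 'n \<Rightarrow> real" where
  "hor_norm \<sigma> x = L2_set (\<lambda>k. x $ k) (first_stratum \<sigma>)"

definition hor_grad ::
  "('n::finite \<Rightarrow> real ^ 'n \<Rightarrow> real ^ 'n) \<Rightarrow> (real ^ 'n \<Rightarrow> complex) \<Rightarrow> real ^ 'n \<Rightarrow> 'n \<Rightarrow> complex" where
  "hor_grad X f x k = vf_apply (X k) f x"

definition hor_dot :: "('n::finite \<Rightarrow> nat) \<Rightarrow> real ^ 'n \<Rightarrow> ('n \<Rightarrow> complex) \<Rightarrow> complex" where
  "hor_dot \<sigma> v w = (\<Sum>k\<in>first_stratum \<sigma>. of_real (v $ k) * w k)"

definition hor_zero :: "('n::finite \<Rightarrow> nat) \<Rightarrow> (real ^ 'n) set" where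
  "hor_zero \<sigma> = {x. \<forall>k\<in>first_stratum \<sigma>. x $ k = 0}"

end

(*
  Both inequalities hold on every stratified group, which makes them equivalent.

  Let V = x'_1 X_1 + ... + x'_N X_N, so that V f is x' . grad_H f. Since the dilations are
  automorphisms, V commutes with them, so its j-th component is homogeneous of degree sigma j.
  Hence d_j V_j is homogeneous of degree 0 and continuous at 0, thus constant; its value at 0 is
  1 or 0 according to whether j lies in the first stratum, so div V = N. For j in the first
  stratum V_j is homogeneous of degree 1, hence V_j = x_j, and V |x'|^2 = 2 |x'|^2. Integrating
  V (|f|^2 / |x'|^(2s)) then gives
    (N - 2 s) int |f|^2 / |x'|^(2s) = - 2 Re int conj f (V f) / |x'|^(2s),
  and the arithmetic-geometric mean inequality yields both claims, for s = 0 and s = 1.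
*)

theory Submission
  imports Defs
begin

section \<open>Integration by parts for compactly supported functions\<close>

lemma integrable_lborel_compact_support:
  fixes h :: "'a::euclidean_space \<Rightarrow> real"
  assumes "compact K" "continuous_on K h" "\<And>x. x \<notin> K \<Longrightarrow> h x = 0"
  shows "integrable lborel h"
proof -
  have "(\<lambda>x. indicator K x *\<^sub>R h x) = h"
  proof
    show "indicator K x *\<^sub>R h x = h x" for x
      using assms(3)[of x] by (cases "x \<in> K") auto
  qed
  with borel_integrable_compact[OF assms(1,2)] show ?thesis by simp
qed

lemma has_derivative_zero_outside:
  assumes "closed K" "\<And>y. y \<notin> K \<Longrightarrow> f y = 0" "x \<notin> K"
  shows "(f has_derivative (\<lambda>_. 0)) (at x)"
proof (rule has_derivative_transform_within_open)
  show "((\<lambda>_. 0) has_derivative (\<lambda>_. 0)) (at x)" by simp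
  show "open (- K)" "x \<in> - K" using assms by auto
qed (use assms in auto)

text \<open>Translation invariance of Lebesgue measure gives every difference quotient of
  \<open>f\<close> in direction \<open>v\<close> the integral 0. The quotients converge pointwise to
  \<open>f' x v\<close>; the mean value theorem and a common bounded support supply the dominating
  function.\<close>

lemma integral_directional_derivative_eq_0:
  fixes f :: "'a::euclidean_space \<Rightarrow> real"
  assumes der: "\<And>x. (f has_derivative f' x) (at x)"
    and K: "compact K" and f0: "\<And>x. x \<notin> K \<Longrightarrow> f x = 0"
    and cont: "continuous_on K (\<lambda>x. f' x v)"
  shows "(LINT x|lborel. f' x v) = 0"
proof -
  define h where "h n = inverse (real (Suc n))" for n
  have h: "h n > 0" "h n \<le> 1" for n by (auto simp: h_def field_simps)
  have h0: "h \<longlonglongrightarrow> 0" unfolding h_def by (rule LIMSEQ_inverse_real_of_nat)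
  define q where "q n x = (f (x + h n *\<^sub>R v) - f x) / h n" for n x
  have f'0: "f' x v = 0" if "x \<notin> K" for x
    using has_derivative_unique[OF der has_derivative_zero_outside[OF compact_imp_closed[OF K] f0 that]]
    by simp
  obtain M0 where M0: "\<And>x. x \<in> K \<Longrightarrow> \<bar>f' x v\<bar> \<le> M0"
    using compact_imp_bounded[OF compact_continuous_image[OF cont K]]
    by (auto simp: bounded_iff)
  \<comment> \<open>The maximum with 0 covers the points off \<open>K\<close>, and also an empty
    \<open>K\<close>, for which \<open>M0\<close> may be negative.\<close>
  define M where "M = max M0 0"
  have M: "\<bar>f' x v\<bar> \<le> M" for x
    using M0[of x] f'0[of x] by (cases "x \<in> K") (auto simp: M_def)
  obtain R where R: "\<And>x. x \<in> K \<Longrightarrow> norm x \<le> R"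
    using compact_imp_bounded[OF K] by (auto simp: bounded_iff)
  have line: "((\<lambda>s. f (x + s *\<^sub>R v)) has_field_derivative f' (x + s *\<^sub>R v) v) (at s)" for x s
  proof -
    have "((\<lambda>s. f (x + s *\<^sub>R v)) has_derivative (\<lambda>t. f' (x + s *\<^sub>R v) (t *\<^sub>R v))) (at s)"
      by (rule has_derivative_compose[OF _ der]) (auto intro!: derivative_eq_intros)
    then show ?thesis
      unfolding has_field_derivative_def
      by (simp add: linear_cmul[OF has_derivative_linear[OF der]] mult.commute[of _ "f' _ v"])
  qed
  have q_lim: "(\<lambda>n. q n x) \<longlonglongrightarrow> f' x v" for x
  proof -
    have "((\<lambda>t. (f (x + t *\<^sub>R v) - f x) / t) \<longlongrightarrow> f' x v) (at 0)"
      using line[of x 0] by (simp add: DERIV_def)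
    moreover have "filterlim h (at 0) sequentially"
      unfolding filterlim_at using h0 h(1) by (simp add: order_less_imp_not_eq2)
    ultimately show ?thesis unfolding q_def by (rule filterlim_compose)
  qed
  have q_bound: "\<bar>q n x\<bar> \<le> M" for n x
  proof -
    obtain z where z: "f (x + h n *\<^sub>R v) - f (x + 0 *\<^sub>R v) = (h n - 0) * f' (x + z *\<^sub>R v) v"
      using MVT2[OF h(1)[of n], of "\<lambda>s. f (x + s *\<^sub>R v)" "\<lambda>s. f' (x + s *\<^sub>R v) v"] line by blast
    then have "q n x = f' (x + z *\<^sub>R v) v" using h(1)[of n] by (simp add: q_def)
    then show ?thesis using M by simp
  qed
  \<comment> \<open>Since \<open>h n \<le> 1\<close>, the shift by \<open>h n *\<^sub>R v\<close>
    moves the support of \<open>f\<close> by at most \<open>norm v\<close>, so one ball serves all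
    \<open>n\<close>.\<close>
  define B where "B = cball (0::'a) (R + norm v)"
  have q_supp: "q n x = 0" if "x \<notin> B" for n x
  proof -
    have x: "norm x > R + norm v" using that by (simp add: B_def)
    have "norm (h n *\<^sub>R v) \<le> norm v"
      using h[of n] by (simp add: mult_left_le_one_le)
    then have "norm (x + h n *\<^sub>R v) > R"
      using x norm_triangle_ineq4[of "x + h n *\<^sub>R v" "h n *\<^sub>R v"] by simp
    moreover have "norm x > R" using x norm_ge_zero[of v] by linarith
    ultimately have "x + h n *\<^sub>R v \<notin> K" "x \<notin> K" using R by force+
    then show ?thesis by (simp add: q_def f0)
  qed
  have fcont: "continuous_on UNIV f"
    by (intro continuous_at_imp_continuous_on ballI has_derivative_continuous[OF der])
  have fint: "integrable lborel f"
    using K f0 continuous_on_subset[OF fcont] by (intro integrable_lborel_compact_support) auto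
  have shift: "integrable lborel (\<lambda>x. f (x + c))"
              "(LINT x|lborel. f (x + c)) = (LINT x|lborel. f x)" for c
  proof -
    have f: "f \<in> borel_measurable borel" using fint by auto
    show "(LINT x|lborel. f (x + c)) = (LINT x|lborel. f x)"
      using integral_distr[of "(+) c" lborel borel f] f
      by (simp add: lborel_distr_plus add.commute)
    show "integrable lborel (\<lambda>x. f (x + c))"
      using integrable_distr_eq[of "(+) c" lborel borel f] f fint
      by (simp add: lborel_distr_plus add.commute)
  qed
  have q_int: "integrable lborel (q n)" "(LINT x|lborel. q n x) = 0" for n
    unfolding q_def using shift fint by auto
  have "(\<lambda>n. LINT x|lborel. q n x) \<longlonglongrightarrow> (LINT x|lborel. f' x v)"
  proof (rule integral_dominated_convergence)
    show qm: "q n \<in> borel_measurable lborel" for n using q_int by auto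
    show "(\<lambda>x. f' x v) \<in> borel_measurable lborel"
      by (rule borel_measurable_LIMSEQ_real[OF q_lim qm])
    show "integrable lborel (\<lambda>x. M * indicator B x)"
      unfolding B_def
      by (intro integrable_mult_right integrable_real_indicator emeasure_lborel_cball_finite) simp
    show "AE x in lborel. norm (q n x) \<le> M * indicator B x" for n
      using q_bound q_supp by (intro always_eventually allI) (auto simp: indicator_def)
  qed (use q_lim in auto)
  then show ?thesis using q_int by (simp add: LIMSEQ_const_iff)
qed

lemma linear_axis_expansion:
  fixes h :: "real ^ 'n::finite \<Rightarrow> 'b::real_vector"
  assumes "linear h"
  shows "h v = (\<Sum>j\<in>UNIV. v $ j *\<^sub>R h (axis j 1))"
proof -
  have "h v = h (\<Sum>j\<in>UNIV. v $ j *\<^sub>R axis j 1)"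
    by (simp flip: scalar_mult_eq_scaleR add: basis_expansion)
  then show ?thesis using assms by (simp add: linear_sum linear_cmul)
qed

text \<open>Each product of \<open>\<phi>\<close> with a component of \<open>V\<close> has compact
  support, so its partial derivative in that coordinate integrates to 0; summing over the
  coordinates gives the claim. Constancy of the diagonal entries of \<open>V'\<close> lets them
  leave the integral and makes the term containing them continuous.\<close>

lemma integral_constant_divergence:
  fixes \<phi> :: "real ^ 'n::finite \<Rightarrow> real" and V :: "real ^ 'n \<Rightarrow> real ^ 'n"
  assumes der: "\<And>x. (\<phi> has_derivative \<phi>' x) (at x)"
    and K: "compact K" and \<phi>0: "\<And>x. x \<notin> K \<Longrightarrow> \<phi> x = 0"
    and cont: "\<And>v. continuous_on K (\<lambda>x. \<phi>' x v)"
    and V: "\<And>x. (V has_derivative V' x) (at x)"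
    and div: "\<And>x j. V' x (axis j 1) $ j = c j"
  shows "(LINT x|lborel. \<phi>' x (V x)) = - sum c UNIV * (LINT x|lborel. \<phi> x)"
    and "integrable lborel (\<lambda>x. \<phi>' x (V x))"
proof -
  have Vc: "continuous_on A V" for A
    by (intro continuous_at_imp_continuous_on ballI has_derivative_continuous[OF V])
  have \<phi>c: "continuous_on A \<phi>" for A
    by (intro continuous_at_imp_continuous_on ballI has_derivative_continuous[OF der])
  have \<phi>'0: "\<phi>' x v = 0" if "x \<notin> K" for x v
    using has_derivative_unique[OF der has_derivative_zero_outside[OF compact_imp_closed[OF K] \<phi>0 that]]
    by simp
  have int: "integrable lborel (\<lambda>x. V x $ j * \<phi>' x (axis j 1))" for j
    using K \<phi>'0 cont Vc
    by (intro integrable_lborel_compact_support[of K]) (auto intro!: continuous_intros)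
  have \<phi>int: "integrable lborel \<phi>"
    using K \<phi>0 \<phi>c by (intro integrable_lborel_compact_support) auto
  have expand: "\<phi>' x (V x) = (\<Sum>j\<in>UNIV. V x $ j * \<phi>' x (axis j 1))" for x
    using linear_axis_expansion[OF has_derivative_linear[OF der], of x "V x"] by simp
  have part: "(LINT x|lborel. V x $ j * \<phi>' x (axis j 1)) = - c j * (LINT x|lborel. \<phi> x)" for j
  proof -
    have "(LINT x|lborel. V x $ j * \<phi>' x (axis j 1) + V' x (axis j 1) $ j * \<phi> x) = 0"
    proof (rule integral_directional_derivative_eq_0[of "\<lambda>x. V x $ j * \<phi> x"
          "\<lambda>x v. V x $ j * \<phi>' x v + V' x v $ j * \<phi> x"])
      show "((\<lambda>x. V x $ j * \<phi> x) has_derivative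
          (\<lambda>v. V x $ j * \<phi>' x v + V' x v $ j * \<phi> x)) (at x)" for x
        by (intro has_derivative_mult der bounded_linear.has_derivative[OF bounded_linear_vec_nth V])
      show "continuous_on K (\<lambda>x. V x $ j * \<phi>' x (axis j 1) + V' x (axis j 1) $ j * \<phi> x)"
        unfolding div by (intro continuous_intros cont Vc \<phi>c)
    qed (use K \<phi>0 in auto)
    then show ?thesis using int \<phi>int by (simp add: div)
  qed
  show "integrable lborel (\<lambda>x. \<phi>' x (V x))"
    unfolding expand using int by auto
  show "(LINT x|lborel. \<phi>' x (V x)) = - sum c UNIV * (LINT x|lborel. \<phi> x)"
    unfolding expand using int by (simp add: part sum_distrib_right sum_negf)
qed

section \<open>The weighted Hardy inequality, free of group structure\<close>

text \<open>The analytic core, with only those properties of the field that the integration uses: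
  \<open>S\<close> stands for the first stratum, \<open>V\<close> for the radial field and
  \<open>\<rho>\<close> for the square of |x'|. The exponents 0 and 1 for \<open>s\<close>
  correspond to the two inequalities of the theorem.\<close>

lemma weighted_hardy_inequality:
  fixes f :: "real ^ 'n::finite \<Rightarrow> complex" and V :: "real ^ 'n \<Rightarrow> real ^ 'n" and s :: nat
    and S :: "'n set"
  defines "\<rho> \<equiv> \<lambda>x. \<Sum>j\<in>S. (x $ j)\<^sup>2"
  assumes V: "\<And>x. (V has_derivative V' x) (at x)"
    and div: "\<And>x j. V' x (axis j 1) $ j = (if j \<in> S then 1 else 0)"
    and VS: "\<And>x j. j \<in> S \<Longrightarrow> V x $ j = x $ j"
    and f: "\<And>x. (f has_derivative f' x) (at x)"
    and f'c: "\<And>v. continuous_on UNIV (\<lambda>x. f' x v)"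
    and K: "compact K" and f0: "\<And>x. x \<notin> K \<Longrightarrow> f x = 0"
    and K0: "\<And>x. x \<in> K \<Longrightarrow> \<rho> x \<noteq> 0"
    and s: "2 * real s < real (card S)"
  shows "sqrt (LINT x|lborel. (cmod (f x))\<^sup>2 / \<rho> x ^ s)
    \<le> 2 / (real (card S) - 2 * real s) * sqrt (LINT x|lborel. (cmod (f' x (V x)))\<^sup>2 / \<rho> x ^ s)"
proof -
  define c where "c = real (card S) - 2 * real s"
  have c: "c > 0" using s by (simp add: c_def)
  \<comment> \<open>The convention \<open>inverse 0 = 0\<close> makes \<open>w\<close> total. Its
    value where \<open>\<rho>\<close> vanishes does not matter, since such points lie off
    \<open>K\<close>, where \<open>f\<close> is 0.\<close>
  define w where "w x = inverse (\<rho> x) ^ s" for x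
  define \<rho>' where "\<rho>' x v = (\<Sum>j\<in>S. 2 * (x $ j) * v $ j)" for x v :: "real ^ 'n"
  define \<phi> where "\<phi> x = (cmod (f x))\<^sup>2 * w x" for x
  \<comment> \<open>Product and chain rule. The real inner product on the complex numbers,
    \<open>f x \<bullet> f' x v\<close>, is the real part of conj(f) times the derivative of
    f.\<close>
  define \<phi>' where "\<phi>' x v = 2 * (f x \<bullet> f' x v) * w x
      - (cmod (f x))\<^sup>2 * (real s * w x * inverse (\<rho> x) * \<rho>' x v)" for x v
  define J where "J x = (cmod (f' x (V x)))\<^sup>2 * w x" for x
  have \<rho>d: "(\<rho> has_derivative \<rho>' x) (at x)" for x
    unfolding \<rho>_def \<rho>'_def
    by (auto intro!: derivative_eq_intros bounded_linear.has_derivative[OF bounded_linear_vec_nth] simp: mult_ac)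
  have \<rho>c: "continuous_on A \<rho>" for A
    by (intro continuous_at_imp_continuous_on ballI has_derivative_continuous[OF \<rho>d])
  have fc: "continuous_on A f" for A
    by (intro continuous_at_imp_continuous_on ballI has_derivative_continuous[OF f])
  have Vc: "continuous_on A V" for A
    by (intro continuous_at_imp_continuous_on ballI has_derivative_continuous[OF V])
  have f'cA: "continuous_on A (\<lambda>x. f' x v)" for A v
    using continuous_on_subset[OF f'c] by blast
  have f'0: "f' x v = 0" if "x \<notin> K" for x v
    using has_derivative_unique[OF f has_derivative_zero_outside[OF compact_imp_closed[OF K] f0 that]]
    by simp
  have wc: "continuous_on K w"
    unfolding w_def using K0 by (intro continuous_intros \<rho>c) auto
  \<comment> \<open>Splitting off \<open>s = 0\<close> turns the exponent \<open>s - 1\<close> of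
    the power rule into a genuine predecessor.\<close>
  have wd: "(w has_derivative (\<lambda>v. - (real s * w x * inverse (\<rho> x) * \<rho>' x v))) (at x)"
    if "\<rho> x \<noteq> 0" for x
  proof (cases s)
    case 0
    then show ?thesis unfolding w_def by simp
  next
    case (Suc n)
    show ?thesis unfolding w_def Suc
      by (rule derivative_eq_intros \<rho>d that refl)+ (use that in \<open>simp add: fun_eq_iff algebra_simps\<close>)
  qed
  have \<phi>d: "(\<phi> has_derivative \<phi>' x) (at x)" for x
  proof (cases "x \<in> K")
    case True
    have "((\<lambda>x. (f x \<bullet> f x) * w x) has_derivative
        (\<lambda>v. (f x \<bullet> f x) * - (real s * w x * inverse (\<rho> x) * \<rho>' x v)
           + (f x \<bullet> f' x v + f' x v \<bullet> f x) * w x)) (at x)"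
      by (intro has_derivative_mult has_derivative_inner f wd K0 True)
    then show ?thesis
      unfolding \<phi>_def \<phi>'_def power2_norm_eq_inner
      by (rule has_derivative_eq_rhs) (simp add: fun_eq_iff inner_commute algebra_simps)
  next
    case False
    have "(\<phi> has_derivative (\<lambda>_. 0)) (at x)"
      by (rule has_derivative_zero_outside[OF compact_imp_closed[OF K] _ False]) (simp add: \<phi>_def f0)
    moreover have "\<phi>' x = (\<lambda>_. 0)"
      using False by (simp add: \<phi>'_def f0 f'0 fun_eq_iff)
    ultimately show ?thesis by simp
  qed
  have \<phi>0: "\<phi> x = 0" if "x \<notin> K" for x using that by (simp add: \<phi>_def f0)
  have \<phi>'c: "continuous_on K (\<lambda>x. \<phi>' x v)" for v
    unfolding \<phi>'_def \<rho>'_def using K0 by (intro continuous_intros fc f'cA wc \<rho>c) auto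
  have \<phi>int: "integrable lborel \<phi>"
    by (rule integrable_lborel_compact_support[OF K])
      (auto simp: \<phi>_def f0 intro!: continuous_intros fc wc)
  have f'V: "f' x (V x) = (\<Sum>j\<in>UNIV. V x $ j *\<^sub>R f' x (axis j 1))" for x
    by (rule linear_axis_expansion[OF has_derivative_linear[OF f]])
  have Jint: "integrable lborel J"
    by (rule integrable_lborel_compact_support[OF K])
      (auto simp: J_def f'0 f'V intro!: continuous_intros f'cA wc Vc)
  have \<rho>'V: "\<rho>' x (V x) = 2 * \<rho> x" for x
    unfolding \<rho>'_def \<rho>_def by (simp add: VS sum_distrib_left power2_eq_square mult_ac)
  have \<phi>'V: "\<phi>' x (V x) = 2 * (f x \<bullet> f' x (V x)) * w x - 2 * real s * \<phi> x" for x
    using K0[of x] f0[of x] by (cases "x \<in> K") (auto simp: \<phi>'_def \<phi>_def \<rho>'V field_simps)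
  note div_thm = integral_constant_divergence[OF \<phi>d K \<phi>0 \<phi>'c V div]
  \<comment> \<open>This is 2ab \<le> (c/2) a^2 + (2/c) b^2 with a = |f| and b = |Vf|. The weights
    are chosen so that exactly half of \<open>c\<close> times the integral of \<open>\<phi>\<close>
    is absorbed on the left, which leaves the constant (2/c)^2.\<close>
  have le: "- \<phi>' x (V x) - 2 * real s * \<phi> x \<le> c / 2 * \<phi> x + 2 / c * J x" for x
  proof -
    let ?a = "cmod (f x)" and ?b = "cmod (f' x (V x))"
    have "0 \<le> 2 / c * (c / 2 * ?a - ?b)\<^sup>2" using c by simp
    also have "\<dots> = c / 2 * ?a\<^sup>2 + 2 / c * ?b\<^sup>2 - 2 * (?a * ?b)"
      using c by (simp add: power2_eq_square field_simps)
    also have "\<dots> \<le> c / 2 * ?a\<^sup>2 + 2 / c * ?b\<^sup>2 + 2 * (f x \<bullet> f' x (V x))"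
      using Cauchy_Schwarz_ineq2[of "f x" "f' x (V x)"] by linarith
    finally have "0 \<le> (c / 2 * ?a\<^sup>2 + 2 / c * ?b\<^sup>2 + 2 * (f x \<bullet> f' x (V x))) * w x"
      by (intro mult_nonneg_nonneg) (simp_all add: w_def \<rho>_def sum_nonneg)
    then show ?thesis unfolding \<phi>'V \<phi>_def J_def by (simp add: algebra_simps)
  qed
  let ?I = "LINT x|lborel. \<phi> x" and ?J = "LINT x|lborel. J x"
  \<comment> \<open>The divergence contributes \<open>card S\<close>, and the derivative of the
    weight along \<open>V\<close> contributes \<open>- 2 * real s\<close>; together they make up
    \<open>c\<close>.\<close>
  have "c * ?I = (LINT x|lborel. - \<phi>' x (V x) - 2 * real s * \<phi> x)"
    using div_thm \<phi>int by (simp add: c_def left_diff_distrib sum.If_cases)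
  also have "\<dots> \<le> (LINT x|lborel. c / 2 * \<phi> x + 2 / c * J x)"
    using div_thm(2) \<phi>int Jint by (intro integral_mono le) auto
  also have "\<dots> = c / 2 * ?I + 2 / c * ?J"
    using \<phi>int Jint by simp
  finally have "?I \<le> (2 / c)\<^sup>2 * ?J"
    using c by (simp add: power2_eq_square field_simps)
  then have "sqrt ?I \<le> sqrt ((2 / c)\<^sup>2 * ?J)" by simp
  also have "\<dots> = 2 / c * sqrt ?J" using c by (simp add: real_sqrt_mult)
  finally show ?thesis
    by (simp add: \<phi>_def J_def w_def c_def divide_inverse power_inverse)
qed

section \<open>Dilations and vector fields commuting with them\<close>

lemma linear_dilation: "linear (dilation \<sigma> t)"
  by (rule linearI) (simp_all add: dilation_def vec_eq_iff algebra_simps)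

lemma dilation_has_derivative: "(dilation \<sigma> t has_derivative dilation \<sigma> t) (at x)"
  by (rule linear_imp_has_derivative[OF linear_dilation])

lemma dilation_axis: "dilation \<sigma> t (axis j 1) = t ^ \<sigma> j *\<^sub>R axis j 1"
  by (simp add: dilation_def vec_eq_iff axis_def)

text \<open>The coordinates of degree at least 2 vanish to higher order as t tends to 0, so the
  curve of dilates of \<open>x\<close> passes through 0 with velocity (x', 0).\<close>

lemma dilation_has_vector_derivative_0:
  fixes x :: "real ^ 'n::finite"
  assumes \<sigma>: "\<And>i. 1 \<le> \<sigma> i"
  shows "((\<lambda>t. dilation \<sigma> t x) has_vector_derivative (\<chi> i. if \<sigma> i = 1 then x $ i else 0)) (at 0)"
proof -
  have pow: "((\<lambda>t. t ^ \<sigma> i * x $ i) has_derivative (\<lambda>t. t * (if \<sigma> i = 1 then x $ i else 0))) (at 0)" for i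
  proof -
    have "((\<lambda>t. t ^ \<sigma> i * x $ i) has_real_derivative (real (\<sigma> i) * 0 ^ (\<sigma> i - 1)) * x $ i) (at 0)"
      by (auto intro!: derivative_eq_intros)
    \<comment> \<open>The convention \<open>0 ^ 0 = 1\<close> singles out the coordinates of degree
      1.\<close>
    moreover have "(real (\<sigma> i) * 0 ^ (\<sigma> i - 1)) * x $ i = (if \<sigma> i = 1 then x $ i else 0)"
      using \<sigma>[of i] by (auto simp: zero_power)
    ultimately show ?thesis by (simp add: has_field_derivative_def mult.commute[of _ "if _ then _ else _"])
  qed
  show ?thesis
    unfolding has_vector_derivative_def
  proof (rule has_derivative_componentwise_within[THEN iffD2], rule ballI)
    fix b :: "real ^ 'n" assume "b \<in> Basis"
    then obtain i where b: "b = axis i 1" by (auto simp: Basis_vec_def)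
    show "((\<lambda>t. dilation \<sigma> t x \<bullet> b) has_derivative
        (\<lambda>t. (t *\<^sub>R (\<chi> i. if \<sigma> i = 1 then x $ i else 0)) \<bullet> b)) (at 0)"
      unfolding b cart_eq_inner_axis[symmetric] using pow[of i] by (simp add: dilation_def)
  qed
qed

text \<open>Differentiating the commutation relation shows that the diagonal entries of
  \<open>V'\<close> are constant along dilation orbits, and continuity carries them to the limit 0
  of each orbit. A component of degree 1 is linear in t along an orbit, so it equals its derivative
  at t = 0, which the chain rule computes.\<close>

lemma homogeneous_vector_field:
  fixes V :: "real ^ 'n::finite \<Rightarrow> real ^ 'n"
  assumes \<sigma>: "\<And>i. 1 \<le> \<sigma> i"
    and V: "\<And>x. (V has_derivative V' x) (at x)"
    and cont: "\<And>v. continuous_on UNIV (\<lambda>x. V' x v)"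
    and hom: "\<And>t x. t > 0 \<Longrightarrow> V (dilation \<sigma> t x) = dilation \<sigma> t (V x)"
  shows "V' x (axis j 1) $ j = V' 0 (axis j 1) $ j"
    and "\<sigma> j = 1 \<Longrightarrow> V x $ j = V' 0 (\<chi> i. if \<sigma> i = 1 then x $ i else 0) $ j"
proof -
  have dil0: "dilation \<sigma> 0 x = 0"
    using order.strict_trans2[OF zero_less_one \<sigma>] by (simp add: dilation_def vec_eq_iff zero_power)
  have lim: "((\<lambda>t. dilation \<sigma> t x) \<longlongrightarrow> 0) (at_right 0)"
  proof -
    have "isCont (\<lambda>t. dilation \<sigma> t x) 0"
      using has_vector_derivative_continuous[OF dilation_has_vector_derivative_0[OF \<sigma>]] .
    then show ?thesis
      using filterlim_at_split isCont_def dil0 by metis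
  qed
  have pos: "eventually (\<lambda>t::real. t > 0) (at_right 0)"
    by (simp add: eventually_at_right_less)
  have deriv_hom: "V' (dilation \<sigma> t x) (axis j 1) $ j = V' x (axis j 1) $ j" if t: "t > 0" for t
  proof -
    have "((\<lambda>y. V (dilation \<sigma> t y)) has_derivative (\<lambda>v. V' (dilation \<sigma> t x) (dilation \<sigma> t v))) (at x)"
      by (rule has_derivative_compose[OF dilation_has_derivative V])
    moreover have "((\<lambda>y. V (dilation \<sigma> t y)) has_derivative (\<lambda>v. dilation \<sigma> t (V' x v))) (at x)"
      unfolding hom[OF t] by (rule has_derivative_compose[OF V dilation_has_derivative])
    ultimately have "(\<lambda>v. V' (dilation \<sigma> t x) (dilation \<sigma> t v)) = (\<lambda>v. dilation \<sigma> t (V' x v))"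
      by (rule has_derivative_unique)
    then have "V' (dilation \<sigma> t x) (dilation \<sigma> t (axis j 1)) $ j = dilation \<sigma> t (V' x (axis j 1)) $ j"
      by metis
    \<comment> \<open>The powers of \<open>t\<close> on the two sides agree because row and column
      index coincide; an off-diagonal entry would keep a power of \<open>t\<close>.\<close>
    then have "t ^ \<sigma> j * V' (dilation \<sigma> t x) (axis j 1) $ j = t ^ \<sigma> j * V' x (axis j 1) $ j"
      unfolding dilation_axis linear_cmul[OF has_derivative_linear[OF V]]
      by (simp add: dilation_def)
    then show ?thesis using t by simp
  qed
  have "((\<lambda>t. V' (dilation \<sigma> t x) (axis j 1) $ j) \<longlongrightarrow> V' 0 (axis j 1) $ j) (at_right 0)"
    by (intro tendsto_vec_nth continuous_on_tendsto_compose[OF cont lim]) auto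
  moreover have "((\<lambda>t. V' (dilation \<sigma> t x) (axis j 1) $ j) \<longlongrightarrow> V' x (axis j 1) $ j) (at_right 0)"
    by (rule tendsto_eventually, rule eventually_mono[OF pos], rule deriv_hom)
  ultimately show "V' x (axis j 1) $ j = V' 0 (axis j 1) $ j"
    using tendsto_unique trivial_limit_at_right_real by blast
  assume j: "\<sigma> j = 1"
  have scale: "V (dilation \<sigma> t x) $ j = t * V x $ j" if "t > 0" for t
    using hom[OF that] j by (simp add: dilation_def)
  let ?h = "\<lambda>t. V (dilation \<sigma> t x) $ j"
  have h': "((\<lambda>t. V (dilation \<sigma> t x)) has_vector_derivative
      V' 0 (\<chi> i. if \<sigma> i = 1 then x $ i else 0)) (at 0)"
    using vector_derivative_diff_chain_within[OF dilation_has_vector_derivative_0[of \<sigma> x, OF \<sigma>], of V "V' 0"]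
      has_derivative_at_withinI[OF V[of 0]] by (simp add: dil0 o_def)
  then have h: "(?h has_real_derivative V' 0 (\<chi> i. if \<sigma> i = 1 then x $ i else 0) $ j) (at 0)"
    using bounded_linear.has_vector_derivative[OF bounded_linear_vec_nth]
    by (simp add: has_real_derivative_iff_has_vector_derivative)
  \<comment> \<open>Homogeneity is known only for t > 0, so \<open>?h 0 = 0\<close> comes from the
    limit from the right. The difference quotient at 0 is then \<open>?h t / t\<close>, which is
    constant for t > 0.\<close>
  have "isCont ?h 0" using h by (rule DERIV_isCont)
  then have "(?h \<longlongrightarrow> ?h 0) (at_right 0)"
    using filterlim_at_split isCont_def by metis
  moreover have "(?h \<longlongrightarrow> 0) (at_right 0)"
  proof (rule Lim_transform_eventually)
    show "((\<lambda>t. t * V x $ j) \<longlongrightarrow> 0) (at_right 0)"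
      by (rule tendsto_mult_left_zero) (rule tendsto_ident_at)
    show "\<forall>\<^sub>F t in at_right 0. t * V x $ j = ?h t"
      by (rule eventually_mono[OF pos]) (simp add: scale)
  qed
  ultimately have h0: "?h 0 = 0"
    using tendsto_unique trivial_limit_at_right_real by blast
  have "((\<lambda>t. ?h t / t) \<longlongrightarrow> V' 0 (\<chi> i. if \<sigma> i = 1 then x $ i else 0) $ j) (at_right 0)"
    using h unfolding DERIV_def h0 by (simp add: filterlim_at_split)
  moreover have "((\<lambda>t. ?h t / t) \<longlongrightarrow> V x $ j) (at_right 0)"
    by (rule tendsto_eventually, rule eventually_mono[OF pos]) (simp add: scale)
  ultimately show "V x $ j = V' 0 (\<chi> i. if \<sigma> i = 1 then x $ i else 0) $ j"
    using tendsto_unique trivial_limit_at_right_real by blast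
qed

section \<open>Consequences of smoothness\<close>

lemma smooth_has_derivative:
  assumes "smooth f"
  shows "(f has_derivative frechet_derivative f (at x)) (at x)"
proof -
  have "k_smooth (Suc 0) f" using assms by (simp only: smooth_def)
  then show ?thesis by (simp add: frechet_derivative_works)
qed

lemma smooth_frechet_derivative:
  assumes "smooth f"
  shows "smooth (\<lambda>x. frechet_derivative f (at x) v)"
  unfolding smooth_def
proof
  fix k
  have "k_smooth (Suc k) f" using assms by (simp only: smooth_def)
  then show "k_smooth k (\<lambda>x. frechet_derivative f (at x) v)" by simp
qed

lemma smooth_continuous:
  assumes "smooth f"
  shows "continuous_on A f"
proof -
  have "k_smooth 0 f" using assms by (simp only: smooth_def)
  then show ?thesis by (simp add: continuous_on_subset[OF _ subset_UNIV])
qed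

section \<open>The radial field of a stratified group\<close>

text \<open>The operator x' . grad_H is made a single vector field here, so that it has a divergence
  and can be tested for homogeneity.\<close>

definition radial_field ::
  "('n::finite \<Rightarrow> nat) \<Rightarrow> ('n \<Rightarrow> real ^ 'n \<Rightarrow> real ^ 'n) \<Rightarrow> real ^ 'n \<Rightarrow> real ^ 'n" where
  "radial_field \<sigma> X x = (\<Sum>k\<in>first_stratum \<sigma>. x $ k *\<^sub>R X k x)"

context stratified_group
begin

lemma dilation_mult:
  assumes "t > 0"
  shows "dilation \<sigma> t (x \<otimes> y) = dilation \<sigma> t x \<otimes> dilation \<sigma> t y"
  using dilation_automorphism[OF assms] by (simp add: iso_def hom_def carrier_UNIV)

text \<open>Automorphisms fix the identity, and the dilation by 2 fixes only 0 because all degrees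
  are at least 1. This links \<open>X_at_0\<close>, a condition at 0, with left invariance, which
  transports values from the identity.\<close>

lemma one_eq_0: "\<one> = 0"
proof -
  have "dilation \<sigma> 2 \<in> hom G G"
    using dilation_automorphism[of 2] by (simp add: iso_def)
  then have fix1: "dilation \<sigma> 2 \<one> = \<one>"
    using hom_one is_group by blast
  have "\<one> $ i = 0" for i
  proof -
    have "2 ^ \<sigma> i * \<one> $ i = \<one> $ i"
      using arg_cong[OF fix1, of "\<lambda>v. v $ i"] by (simp add: dilation_def)
    moreover have "(2::real) ^ \<sigma> i > 1"
      using strata[of i] by (intro one_less_power) auto
    ultimately show ?thesis by simp
  qed
  then show ?thesis by (simp add: vec_eq_iff)
qed

text \<open>The chain rule for y \<mapsto> (a, y). Writing the differential through the joint
  derivative of the multiplication keeps its smooth dependence on \<open>a\<close> visible.\<close>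

lemma left_translation_has_derivative:
  "((\<lambda>y. a \<otimes> y) has_derivative
     (\<lambda>v. frechet_derivative (\<lambda>p. fst p \<otimes> snd p) (at (a, x)) (0, v))) (at x)"
proof -
  have "((\<lambda>y. (a, y)) has_derivative (\<lambda>v. (0, v))) (at x)"
    by (intro derivative_intros)
  from has_derivative_compose[OF this smooth_has_derivative[OF smooth_mult]]
  show ?thesis by simp
qed

text \<open>Left invariance at the identity pushes the basis vector forward by the translation by
  \<open>a\<close>. The formula is the source of both the homogeneity and the regularity of
  \<open>X k\<close>.\<close>

lemma X_eq:
  assumes "k \<in> first_stratum \<sigma>"
  shows "X k a = frechet_derivative (\<lambda>p. fst p \<otimes> snd p) (at (a, 0)) (0, axis k 1)"
proof -
  have "X k (a \<otimes> \<one>) = frechet_derivative (\<lambda>y. a \<otimes> y) (at 0) (axis k 1)"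
    using X_left_invariant[OF assms] X_at_0[OF assms] one_eq_0
    unfolding left_invariant_def by metis
  moreover have "a \<otimes> \<one> = a" by (simp add: carrier_UNIV)
  ultimately show ?thesis
    by (simp flip: frechet_derivative_at[OF left_translation_has_derivative[of a 0]])
qed

text \<open>The automorphism identity for the product of \<open>a\<close> and \<open>y\<close> is
  differentiated in \<open>y\<close> at 0 along \<open>axis k 1\<close>, an eigenvector of the
  dilation with eigenvalue \<open>t\<close>.\<close>

lemma X_homogeneous:
  assumes k: "k \<in> first_stratum \<sigma>" and t: "t > 0"
  shows "t *\<^sub>R X k (dilation \<sigma> t a) = dilation \<sigma> t (X k a)"
proof -
  let ?D = "\<lambda>a v. frechet_derivative (\<lambda>p. fst p \<otimes> snd p) (at (a, 0)) (0, v)"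
  have "((\<lambda>y. dilation \<sigma> t a \<otimes> dilation \<sigma> t y) has_derivative
      (\<lambda>v. ?D (dilation \<sigma> t a) (dilation \<sigma> t v))) (at 0)"
    using has_derivative_compose[OF dilation_has_derivative
        left_translation_has_derivative[of "dilation \<sigma> t a" "dilation \<sigma> t 0"]]
    by (simp add: linear_0[OF linear_dilation])
  moreover have "((\<lambda>y. dilation \<sigma> t a \<otimes> dilation \<sigma> t y) has_derivative
      (\<lambda>v. dilation \<sigma> t (?D a v))) (at 0)"
    unfolding dilation_mult[OF t, symmetric]
    by (rule has_derivative_compose[OF left_translation_has_derivative dilation_has_derivative])
  ultimately have "(\<lambda>v. ?D (dilation \<sigma> t a) (dilation \<sigma> t v)) = (\<lambda>v. dilation \<sigma> t (?D a v))"
    by (rule has_derivative_unique)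
  then have "?D (dilation \<sigma> t a) (dilation \<sigma> t (axis k 1)) = dilation \<sigma> t (?D a (axis k 1))"
    by (rule fun_cong)
  moreover have "dilation \<sigma> t (axis k 1) = t *\<^sub>R axis k 1"
    using k by (simp add: dilation_axis first_stratum_def)
  moreover have "?D b (t *\<^sub>R v) = t *\<^sub>R ?D b v" for b v
    using linear_cmul[OF has_derivative_linear[OF left_translation_has_derivative]] .
  ultimately show ?thesis by (simp add: X_eq[OF k])
qed

text \<open>By \<open>X_eq\<close>, the field is the restriction to the slice of pairs
  \<open>(a, 0)\<close> of a derivative of the multiplication, which is smooth on the product
  space.\<close>

lemma X_has_derivative:
  assumes k: "k \<in> first_stratum \<sigma>"
  obtains X' where "\<And>x. (X k has_derivative X' x) (at x)"
    and "\<And>v. continuous_on UNIV (\<lambda>x. X' x v)"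
proof -
  define F where "F p = frechet_derivative (\<lambda>p. fst p \<otimes> snd p) (at p) (0, axis k 1)" for p
  have F: "smooth F" unfolding F_def by (rule smooth_frechet_derivative[OF smooth_mult])
  show thesis
  proof
    show "(X k has_derivative (\<lambda>u. frechet_derivative F (at (x, 0)) (u, 0))) (at x)" for x
    proof -
      have "((\<lambda>y. (y, 0)) has_derivative (\<lambda>v. (v, 0))) (at x)"
        by (intro derivative_intros)
      from has_derivative_compose[OF this smooth_has_derivative[OF F]]
      have "((\<lambda>y. F (y, 0)) has_derivative (\<lambda>u. frechet_derivative F (at (x, 0)) (u, 0))) (at x)" .
      moreover have "(\<lambda>y. F (y, 0)) = X k" by (simp add: fun_eq_iff F_def X_eq[OF k])
      ultimately show ?thesis by simp
    qed
    show "continuous_on UNIV (\<lambda>x. frechet_derivative F (at (x, 0)) (v, 0))" for v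
      by (rule continuous_on_compose2[OF smooth_continuous[OF smooth_frechet_derivative[OF F], where A=UNIV]])
        (auto intro!: continuous_intros)
  qed
qed

text \<open>Homogeneity reduces both the diagonal derivatives and the first stratum components to
  the derivative at 0, and that is the projection onto the first stratum.\<close>

lemma radial_field_properties:
  obtains V' where "\<And>x. (radial_field \<sigma> X has_derivative V' x) (at x)"
    and "\<And>x j. V' x (axis j 1) $ j = (if j \<in> first_stratum \<sigma> then 1 else 0)"
    and "\<And>x j. j \<in> first_stratum \<sigma> \<Longrightarrow> radial_field \<sigma> X x $ j = x $ j"
proof -
  have "\<exists>X'. (\<forall>x. (X k has_derivative X' x) (at x)) \<and> (\<forall>v. continuous_on UNIV (\<lambda>x. X' x v))"
    if "k \<in> first_stratum \<sigma>" for k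
    using X_has_derivative[OF that] by metis
  then obtain X' where X': "\<And>k x. k \<in> first_stratum \<sigma> \<Longrightarrow> (X k has_derivative X' k x) (at x)"
    and X'c: "\<And>k v. k \<in> first_stratum \<sigma> \<Longrightarrow> continuous_on UNIV (\<lambda>x. X' k x v)"
    by metis
  have Xc: "continuous_on UNIV (X k)" if "k \<in> first_stratum \<sigma>" for k
    by (intro continuous_at_imp_continuous_on ballI has_derivative_continuous[OF X'[OF that]])
  define V' where "V' x u = (\<Sum>k\<in>first_stratum \<sigma>. x $ k *\<^sub>R X' k x u + u $ k *\<^sub>R X k x)" for x u
  have V: "(radial_field \<sigma> X has_derivative V' x) (at x)" for x
    unfolding radial_field_def[abs_def] V'_def
    by (intro has_derivative_sum has_derivative_scaleR X'
        bounded_linear.has_derivative[OF bounded_linear_vec_nth has_derivative_ident])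
  have V'c: "continuous_on UNIV (\<lambda>x. V' x v)" for v
    unfolding V'_def by (intro continuous_intros X'c Xc)
  \<comment> \<open>The factor \<open>t\<close> from \<open>X_homogeneous\<close> is matched by the
    degree 1 coordinate \<open>x $ k\<close>.\<close>
  have hom: "radial_field \<sigma> X (dilation \<sigma> t x) = dilation \<sigma> t (radial_field \<sigma> X x)" if "t > 0" for t x
    unfolding radial_field_def linear_sum[OF linear_dilation] linear_cmul[OF linear_dilation]
  proof (rule sum.cong[OF refl])
    fix k assume k: "k \<in> first_stratum \<sigma>"
    then have "dilation \<sigma> t x $ k = x $ k * t"
      by (simp add: dilation_def first_stratum_def)
    then show "dilation \<sigma> t x $ k *\<^sub>R X k (dilation \<sigma> t x) = x $ k *\<^sub>R dilation \<sigma> t (X k x)"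
      by (simp flip: X_homogeneous[OF k that])
  qed
  \<comment> \<open>At 0 the product rule keeps only the terms that differentiate the coefficient,
    and there \<open>X k 0 = axis k 1\<close>.\<close>
  have V'0: "V' 0 u $ j = (if j \<in> first_stratum \<sigma> then u $ j else 0)" for u j
  proof -
    have "V' 0 u $ j = (\<Sum>k\<in>first_stratum \<sigma>. (u $ k *\<^sub>R X k 0) $ j)"
      by (simp add: V'_def)
    also have "\<dots> = (\<Sum>k\<in>first_stratum \<sigma>. if j = k then u $ k else 0)"
      by (rule sum.cong[OF refl]) (simp add: X_at_0 axis_def)
    also have "\<dots> = (if j \<in> first_stratum \<sigma> then u $ j else 0)"
      by (rule sum.delta') simp
    finally show ?thesis .
  qed
  have \<sigma>: "1 \<le> \<sigma> i" for i using strata[of i] by simp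
  note H = homogeneous_vector_field[of \<sigma>, OF \<sigma> V V'c hom]
  show thesis
  proof (rule that[OF V])
    show "V' x (axis j 1) $ j = (if j \<in> first_stratum \<sigma> then 1 else 0)" for x j
      using H(1)[of x j] by (simp add: V'0)
    show "radial_field \<sigma> X x $ j = x $ j" if "j \<in> first_stratum \<sigma>" for x j
      using H(2)[of j x] that by (simp add: V'0 first_stratum_def)
  qed
qed

end

section \<open>Transfer to test functions and horizontal gradients\<close>

text \<open>Lebesgue measure is the completion of \<open>lborel\<close>, and a Borel integrand has
  the same integral for both.\<close>

lemma L2_norm_eq:
  assumes "\<And>x. (cmod (F x))\<^sup>2 = h x" and "h \<in> borel_measurable borel"
  shows "L2_norm F = sqrt (LINT x|lborel. h x)"
  using assms by (simp add: L2_norm_def integral_completion)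

lemma hor_norm_square: "(hor_norm \<sigma> x)\<^sup>2 = (\<Sum>j\<in>first_stratum \<sigma>. (x $ j)\<^sup>2)"
  by (simp add: hor_norm_def L2_set_def sum_nonneg)

lemma hor_dot_scaleR: "hor_dot \<sigma> (a *\<^sub>R v) w = of_real a * hor_dot \<sigma> v w"
  by (simp add: hor_dot_def sum_distrib_left mult.assoc)

lemma hor_dot_hor_grad:
  assumes "(f has_derivative f') (at x)"
  shows "hor_dot \<sigma> x (hor_grad X f x) = f' (radial_field \<sigma> X x)"
proof -
  have "linear f'" by (rule has_derivative_linear[OF assms])
  then show ?thesis
    by (simp add: hor_dot_def hor_grad_def vf_apply_def radial_field_def linear_sum linear_cmul
        scaleR_conv_of_real[where 'a=complex] flip: frechet_derivative_at[OF assms])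
qed

lemma (in stratified_group) weighted_hardy_test_functions:
  assumes f: "f \<in> test_functions (UNIV - hor_zero \<sigma>)"
    and s: "2 * real s < real (card (first_stratum \<sigma>))"
  shows "L2_norm (\<lambda>x. f x / of_real (hor_norm \<sigma> x) ^ s)
    \<le> 2 / (real (card (first_stratum \<sigma>)) - 2 * real s) *
      L2_norm (\<lambda>x. hor_dot \<sigma> x (hor_grad X f x) / of_real (hor_norm \<sigma> x) ^ s)"
proof -
  define \<rho> where "\<rho> x = (\<Sum>j\<in>first_stratum \<sigma>. (x $ j)\<^sup>2)" for x :: "real ^ 'n"
  define f' where "f' x = frechet_derivative f (at x)" for x
  define K where "K = closure {x. f x \<noteq> 0}"
  have sm: "smooth f" and K: "compact K" and K0: "K \<subseteq> UNIV - hor_zero \<sigma>"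
    using f by (auto simp: test_functions_def K_def)
  have fd: "(f has_derivative f' x) (at x)" for x
    unfolding f'_def by (rule smooth_has_derivative[OF sm])
  have f'c: "continuous_on UNIV (\<lambda>x. f' x v)" for v
    unfolding f'_def by (rule smooth_continuous[OF smooth_frechet_derivative[OF sm]])
  have f0: "f x = 0" if "x \<notin> K" for x
    using that closure_subset[of "{x. f x \<noteq> 0}"] by (auto simp: K_def)
  have \<rho>0: "\<rho> x \<noteq> 0" if "x \<in> K" for x
    using K0 that by (auto simp: \<rho>_def hor_zero_def sum_nonneg_eq_0_iff)
  obtain V' where V: "\<And>x. (radial_field \<sigma> X has_derivative V' x) (at x)"
    and div: "\<And>x j. V' x (axis j 1) $ j = (if j \<in> first_stratum \<sigma> then 1 else 0)"
    and VS: "\<And>x j. j \<in> first_stratum \<sigma> \<Longrightarrow> radial_field \<sigma> X x $ j = x $ j"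
    using radial_field_properties by metis
  have Vc: "continuous_on UNIV (radial_field \<sigma> X)"
    by (intro continuous_at_imp_continuous_on ballI has_derivative_continuous[OF V])
  have expand: "f' x (radial_field \<sigma> X x) = (\<Sum>j\<in>UNIV. radial_field \<sigma> X x $ j *\<^sub>R f' x (axis j 1))" for x
    by (rule linear_axis_expansion[OF has_derivative_linear[OF fd]])
  have "continuous_on UNIV (\<lambda>x. f' x (radial_field \<sigma> X x))"
    unfolding expand by (intro continuous_intros Vc f'c)
  then have meas: "(\<lambda>x. f' x (radial_field \<sigma> X x)) \<in> borel_measurable borel"
      "f \<in> borel_measurable borel" "\<rho> \<in> borel_measurable borel"
    using smooth_continuous[OF sm] unfolding \<rho>_def
    by (auto intro!: borel_measurable_continuous_onI continuous_intros)
  \<comment> \<open>Where x' = 0 and \<open>s > 0\<close>, both sides are 0 by the convention for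
    division by zero, so the identity holds everywhere.\<close>
  have norm: "(cmod (z / of_real (hor_norm \<sigma> x) ^ s))\<^sup>2 = (cmod z)\<^sup>2 / \<rho> x ^ s" for z x
  proof -
    have "(\<bar>hor_norm \<sigma> x\<bar> ^ s)\<^sup>2 = ((hor_norm \<sigma> x)\<^sup>2) ^ s"
      by (simp add: power_mult[symmetric] mult.commute power_even_abs)
    then show ?thesis
      by (simp add: norm_divide norm_power power_divide hor_norm_square \<rho>_def)
  qed
  have "L2_norm (\<lambda>x. f x / of_real (hor_norm \<sigma> x) ^ s) = sqrt (LINT x|lborel. (cmod (f x))\<^sup>2 / \<rho> x ^ s)"
    by (rule L2_norm_eq[OF norm]) (use meas in measurable)
  moreover have "L2_norm (\<lambda>x. hor_dot \<sigma> x (hor_grad X f x) / of_real (hor_norm \<sigma> x) ^ s)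
      = sqrt (LINT x|lborel. (cmod (f' x (radial_field \<sigma> X x)))\<^sup>2 / \<rho> x ^ s)"
    unfolding hor_dot_hor_grad[OF fd]
    by (rule L2_norm_eq[OF norm]) (use meas in measurable)
  ultimately show ?thesis
    using weighted_hardy_inequality[OF V div VS fd f'c K f0 _ s] \<rho>0 by (simp add: \<rho>_def)
qed

theorem theorem3p4:
  fixes G :: "(real ^ 'n::finite) monoid"
    and \<sigma> :: "'n \<Rightarrow> nat"
    and r N :: nat
    and X :: "'n \<Rightarrow> real ^ 'n \<Rightarrow> real ^ 'n"
  assumes "stratified_group G \<sigma> r X"
    and "N = card (first_stratum \<sigma>)"
    and "N \<ge> 3"
  shows "(\<forall>f \<in> test_functions (UNIV - hor_zero \<sigma>).
            L2_norm f \<le> 2 / real N * L2_norm (\<lambda>x. hor_dot \<sigma> x (hor_grad X f x)))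
     \<longleftrightarrow>
         (\<forall>g \<in> test_functions (UNIV - hor_zero \<sigma>).
            L2_norm (\<lambda>x. g x / of_real (hor_norm \<sigma> x))
              \<le> 2 / (real N - 2) *
                L2_norm (\<lambda>x. hor_dot \<sigma> (x /\<^sub>R hor_norm \<sigma> x) (hor_grad X g x)))"
proof -
  interpret stratified_group G \<sigma> r X by fact
  have "L2_norm f \<le> 2 / real N * L2_norm (\<lambda>x. hor_dot \<sigma> x (hor_grad X f x))"
    if "f \<in> test_functions (UNIV - hor_zero \<sigma>)" for f
    using weighted_hardy_test_functions[OF that, of 0] assms(2,3) by simp
  \<comment> \<open>With \<open>s = 1\<close> the condition on \<open>s\<close> reads 2 < N. The
    factor 1/|x'| in the vector x'/|x'| moves out of \<open>hor_dot\<close> and becomes the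
    weight.\<close>
  moreover have "L2_norm (\<lambda>x. g x / of_real (hor_norm \<sigma> x)) \<le> 2 / (real N - 2) *
      L2_norm (\<lambda>x. hor_dot \<sigma> (x /\<^sub>R hor_norm \<sigma> x) (hor_grad X g x))"
    if "g \<in> test_functions (UNIV - hor_zero \<sigma>)" for g
    using weighted_hardy_test_functions[OF that, of 1] assms(2,3)
    by (simp add: hor_dot_scaleR field_simps)
  ultimately show ?thesis by blast
qed

end
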